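(* Let $(Q;* )$ be a finite quasigroup quandle. Then for every $n$, the torsion subgroup of the rack homology group $H_n^R(Q)$ is annihilated by $|Q|$; that is, $|Q|\cdot z=0$ for every torsion element $z\in H_n^R(Q)$.
   Context: A quandle is a set $X$ with a binary operation $*:X\times X\to X$ such that: (a) $(a*b)*c=(a*c)*(b*c)$ for all $a,b,c\in X$; (b) for every $b\in X$ the map $X\to X$, $a\mapsto a*b$, is invertible; (c) $a*a=a$ for all $a\in X$. A quasigroup quandle (also called a Latin quandle) is a quandle such that for all $a,b\in X$ the equation $a*x=b$ has a unique solution $x\in X$. Rack homology: let $C_n^R(X)=\mathbb{Z}X^n$ be the free abelian group on $n$-tuples $(x_1,\ldots,x_n)$ of elements of $X$ (so $C_0^R(X)=\mathbb{Z}$), and define $\partial_n:C_n^R(X)\to C_{n-1}^R(X)$ by $$\partial_n(x_1,\ldots,x_n)=\sum_{i=1}^n(-1)^i\bigl(d_i^{( *_0)}-d_i^{( * )}\bigr)(x_1,\ldots,x_n),$$ where $$d_i^{( *_0)}(x_1,\ldots,x_n)=(x_1,\ldots,x_{i-1},x_{i+1},\ldots,x_n),$$ $$d_i^{( * )}(x_1,\ldots,x_n)=(x_1*x_i,\ldots,x_{i-1}*x_i,x_{i+1},\ldots,x_n).$$ Then $(C_*^R(X),\partial_* )$ is a chain complex (the rack chain complex), and $H_n^R(X)$ is its $n$-th homology group (with integer coefficients). *)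

theory Defs
  imports "HOL-Algebra.Free_Abelian_Groups"
begin

locale quandle =
  fixes Q :: "'a set" and op :: "'a \<Rightarrow> 'a \<Rightarrow> 'a" (infixl "\<star>" 70)
  assumes closed: "\<lbrakk>a \<in> Q; b \<in> Q\<rbrakk> \<Longrightarrow> a \<star> b \<in> Q"
    and self_distrib:
      "\<lbrakk>a \<in> Q; b \<in> Q; c \<in> Q\<rbrakk> \<Longrightarrow> (a \<star> b) \<star> c = (a \<star> c) \<star> (b \<star> c)"
    and right_invertible: "b \<in> Q \<Longrightarrow> bij_betw (\<lambda>a. a \<star> b) Q Q"
    and idem: "a \<in> Q \<Longrightarrow> a \<star> a = a"

locale quasigroup_quandle = quandle +
  assumes left_unique_solution: "\<lbrakk>a \<in> Q; b \<in> Q\<rbrakk> \<Longrightarrow> \<exists>!x. x \<in> Q \<and> a \<star> x = b"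

text \<open>The tuple \<open>(x\<^sub>1, \<dots>, x\<^sub>n)\<close> is the list \<open>xs\<close> with \<open>x\<^sub>i = xs ! (i - 1)\<close>; the face
  index \<open>i\<close> below keeps its range \<open>1, \<dots>, n\<close>.\<close>

definition tuples :: "'a set \<Rightarrow> nat \<Rightarrow> 'a list set"
  where "tuples X n = {xs. length xs = n \<and> set xs \<subseteq> X}"

definition face0 :: "nat \<Rightarrow> 'a list \<Rightarrow> 'a list"
  where "face0 i xs = take (i - 1) xs @ drop i xs"

definition face :: "('a \<Rightarrow> 'a \<Rightarrow> 'a) \<Rightarrow> nat \<Rightarrow> 'a list \<Rightarrow> 'a list"
  where "face f i xs = map (\<lambda>x. f x (xs ! (i - 1))) (take (i - 1) xs) @ drop i xs"

definition rack_chain_group :: "'a set \<Rightarrow> nat \<Rightarrow> ('a list \<Rightarrow>\<^sub>0 int) monoid"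
  where "rack_chain_group X n = free_Abelian_group (tuples X n)"

text \<open>In degree \<open>0\<close> the sum is empty, so that \<open>rack_boundary f 0\<close> is the zero map.\<close>

definition rack_boundary ::
    "('a \<Rightarrow> 'a \<Rightarrow> 'a) \<Rightarrow> nat \<Rightarrow> ('a list \<Rightarrow>\<^sub>0 int) \<Rightarrow> ('a list \<Rightarrow>\<^sub>0 int)"
  where "rack_boundary f n =
    frag_extend (\<lambda>xs. \<Sum>i = 1..n.
      frag_cmul ((- 1) ^ i) (frag_of (face0 i xs) - frag_of (face f i xs)))"

definition rack_cycles :: "'a set \<Rightarrow> ('a \<Rightarrow> 'a \<Rightarrow> 'a) \<Rightarrow> nat \<Rightarrow> ('a list \<Rightarrow>\<^sub>0 int) set"
  where "rack_cycles X f n = {c \<in> carrier (rack_chain_group X n). rack_boundary f n c = 0}"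

definition rack_boundaries :: "'a set \<Rightarrow> ('a \<Rightarrow> 'a \<Rightarrow> 'a) \<Rightarrow> nat \<Rightarrow> ('a list \<Rightarrow>\<^sub>0 int) set"
  where "rack_boundaries X f n = rack_boundary f (Suc n) ` carrier (rack_chain_group X (Suc n))"

definition rack_homology_group ::
    "'a set \<Rightarrow> ('a \<Rightarrow> 'a \<Rightarrow> 'a) \<Rightarrow> nat \<Rightarrow> ('a list \<Rightarrow>\<^sub>0 int) set monoid"
  where "rack_homology_group X f n =
    subgroup_generated (rack_chain_group X n) (rack_cycles X f n) Mod rack_boundaries X f n"

text \<open>The group is written multiplicatively, so \<open>k \<cdot> z\<close> is \<open>z [^]\<^bsub>G\<^esub> k\<close>.\<close>

definition torsion_subgroup :: "('a, 'b) monoid_scheme \<Rightarrow> 'a set"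
  where "torsion_subgroup G = {z \<in> carrier G. \<exists>k::nat. k > 0 \<and> z [^]\<^bsub>G\<^esub> k = \<one>\<^bsub>G\<^esub>}"

end

theory Submission
  imports Defs
begin

text \<open>
  Let \<open>S\<^sub>j (x\<^sub>1, \<dots>, x\<^sub>n) = \<Sum>\<^sub>y (y, \<dots>, y, x\<^sub>j\<^sub>+\<^sub>1, \<dots>, x\<^sub>n)\<close>, with \<open>j\<close> copies of \<open>y\<close>. Then \<open>S\<^sub>0\<close> is
  multiplication by \<open>|Q|\<close>, while \<open>S\<^sub>n\<close> takes the same value on all \<open>n\<close>-tuples; as the two faces
  in each term of the boundary cancel under a constant map, \<open>S\<^sub>n\<close> kills boundaries, hence also
  every cycle that represents a torsion class. Consecutive \<open>S\<^sub>j\<close> are chain homotopic: inserting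
  \<open>z\<close> after a constant prefix \<open>a, \<dots>, a\<close> replaces that prefix by \<open>a \<star> z, \<dots>, a \<star> z\<close> in
  the boundary. Taking \<open>a = x\<^sub>j\<^sub>+\<^sub>1\<close> and summing over \<open>z\<close>, or summing over \<open>a\<close> with \<open>z\<close>
  solving \<open>a \<star> z = x\<^sub>j\<^sub>+\<^sub>1\<close>, connects \<open>S\<^sub>j\<^sub>+\<^sub>1\<close> and \<open>S\<^sub>j\<close> to \<open>|Q| (x\<^sub>j\<^sub>+\<^sub>1, \<dots>, x\<^sub>j\<^sub>+\<^sub>1, x\<^sub>j\<^sub>+\<^sub>2, \<dots>, x\<^sub>n)\<close>.
\<close>

section \<open>Faces and boundaries of concatenated tuples\<close>

lemma face0_append:
  "1 \<le> i \<Longrightarrow> i \<le> length u \<Longrightarrow> face0 i (u @ s) = face0 i u @ s"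
  by (simp add: face0_def)

lemma face_append:
  "1 \<le> i \<Longrightarrow> i \<le> length u \<Longrightarrow> face f i (u @ s) = face f i u @ s"
  by (simp add: face_def nth_append)

lemma face0_append_right:
  "1 \<le> k \<Longrightarrow> face0 (length u + k) (u @ s) = u @ face0 k s"
  by (cases k) (simp_all add: face0_def)

lemma face_append_right:
  "1 \<le> k \<Longrightarrow>
    face f (length u + k) (u @ s) = map (\<lambda>x. f x (s ! (k - 1))) u @ face f k s"
  by (cases k) (simp_all add: face_def nth_append)

text \<open>For such \<open>i\<close> a face changes nothing beyond the first \<open>j + 1\<close>
  entries. With \<open>drop_face\<close> this makes both faces agree for any map that ignores the
  first \<open>j\<close> entries.\<close>

lemma drop_face0: "1 \<le> i \<Longrightarrow> i \<le> Suc j \<Longrightarrow> i \<le> length xs \<Longrightarrow> drop j (face0 i xs) = drop (Suc j) xs"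
  by (simp add: face0_def min_absorb2 algebra_simps)

lemma drop_face: "1 \<le> i \<Longrightarrow> i \<le> Suc j \<Longrightarrow> i \<le> length xs \<Longrightarrow> drop j (face f i xs) = drop (Suc j) xs"
  by (simp add: face_def min_absorb2 algebra_simps)

lemma frag_cmul_diff_distrib2: "frag_cmul c (a - b) = frag_cmul c a - frag_cmul c b"
  by (rule poly_mapping_eqI) (simp add: lookup_minus algebra_simps)

lemma frag_extend_diff_fun:
  "frag_extend (\<lambda>x. g x - h x) c = frag_extend g c - frag_extend h c"
  by (simp add: frag_extend_def frag_cmul_diff_distrib2 sum_subtractf)

lemma frag_extend_rack_boundary:
  "frag_extend g (rack_boundary f n (frag_of xs)) =
    (\<Sum>i = 1..n. frag_cmul ((- 1) ^ i) (g (face0 i xs) - g (face f i xs)))"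
  by (simp add: rack_boundary_def frag_extend_sum frag_extend_cmul frag_extend_diff)

text \<open>The part of the boundary of \<open>u @ s\<close> whose faces delete an entry of
  \<open>u\<close>. The other faces will match the boundary of the original tuple in the homotopy
  identity.\<close>

definition prefix_boundary ::
    "('a \<Rightarrow> 'a \<Rightarrow> 'a) \<Rightarrow> 'a list \<Rightarrow> 'a list \<Rightarrow> ('a list \<Rightarrow>\<^sub>0 int)"
  where "prefix_boundary f u s = (\<Sum>i = 1..length u.
    frag_cmul ((- 1) ^ i) (frag_of (face0 i u @ s) - frag_of (face f i u @ s)))"

lemma sum_atLeast1_add:
  fixes m k :: nat
  shows "(\<Sum>i = 1..m + k. g i) = (\<Sum>i = 1..m. g i) + (\<Sum>i = 1..k. (g (m + i) :: 'b :: comm_monoid_add))"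
  by (induction k) (simp_all add: ac_simps)

text \<open>A face inside \<open>u\<close> leaves \<open>s\<close> alone, while a face inside
  \<open>s\<close> also acts on all of \<open>u\<close> by the deleted entry. Taking
  \<open>g\<close> to be \<open>frag_of\<close> gives the boundary itself; taking \<open>g\<close>
  to be a block sum gives the other composite in the homotopy identity.\<close>

lemma frag_extend_rack_boundary_append:
  "frag_extend g (rack_boundary f (length u + length s) (frag_of (u @ s))) =
    (\<Sum>i = 1..length u. frag_cmul ((- 1) ^ i) (g (face0 i u @ s) - g (face f i u @ s))) +
    frag_cmul ((- 1) ^ length u) (\<Sum>k = 1..length s. frag_cmul ((- 1) ^ k)
      (g (u @ face0 k s) - g (map (\<lambda>x. f x (s ! (k - 1))) u @ face f k s)))"
  unfolding frag_extend_rack_boundary sum_atLeast1_add frag_cmul_sum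
  by (intro arg_cong2[where f = plus] sum.cong refl)
    (simp_all add: face0_append face_append face0_append_right face_append_right power_add)

lemma rack_boundary_append:
  "rack_boundary f (length u + length s) (frag_of (u @ s)) = prefix_boundary f u s +
    frag_cmul ((- 1) ^ length u) (\<Sum>k = 1..length s. frag_cmul ((- 1) ^ k)
      (frag_of (u @ face0 k s) - frag_of (map (\<lambda>x. f x (s ! (k - 1))) u @ face f k s)))"
  using frag_extend_rack_boundary_append[of frag_of f u s]
  by (simp add: prefix_boundary_def flip: frag_expansion)

text \<open>The value \<open>0\<close> on tuples of length at most \<open>j\<close> is what makes the homotopy identity hold at
  length \<open>j + 1\<close>, where the boundary consists of such tuples.\<close>

definition block_sum :: "'a set \<Rightarrow> nat \<Rightarrow> ('a \<Rightarrow> 'a \<Rightarrow> 'a list) \<Rightarrow> 'a list \<Rightarrow> ('a list \<Rightarrow>\<^sub>0 int)"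
  where "block_sum Q j B xs =
    (case drop j xs of [] \<Rightarrow> 0 | a # s \<Rightarrow> \<Sum>y\<in>Q. frag_of (B y a @ s))"

definition constant_prefix_sum :: "'a set \<Rightarrow> nat \<Rightarrow> 'a list \<Rightarrow> ('a list \<Rightarrow>\<^sub>0 int)"
  where "constant_prefix_sum Q j xs = (\<Sum>y\<in>Q. frag_of (replicate j y @ drop j xs))"

section \<open>Boundaries of block sums in a quandle\<close>

context quandle
begin

lemma sum_right_translate:
  assumes "c \<in> Q"
  shows "(\<Sum>y\<in>Q. g (y \<star> c)) = (\<Sum>y\<in>Q. g y)"
  using sum.reindex_bij_betw[OF right_invertible[OF assms]] .

text \<open>A face deleting an entry \<open>c\<close> of \<open>s\<close> turns \<open>B y a\<close>
  into \<open>B (y \<star> c) (a \<star> c)\<close> or leaves it alone. Since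
  \<open>y \<star> c\<close> runs through \<open>Q\<close> with \<open>y\<close>, such faces commute
  with the block sum up to sign, and only the faces inside the block remain.\<close>

lemma rack_boundary_block_sum:
  assumes fin: "finite Q"
    and len: "\<And>y a. length (B y a) = Suc (Suc j)"
    and equivariant: "\<And>y a c. y \<in> Q \<Longrightarrow> a \<in> Q \<Longrightarrow> c \<in> Q \<Longrightarrow>
      map (\<lambda>x. x \<star> c) (B y a) = B (y \<star> c) (a \<star> c)"
    and Q: "a \<in> Q" "set s \<subseteq> Q" and p: "length p = j"
  shows "rack_boundary op (Suc (Suc (j + length s))) (block_sum Q j B (p @ a # s)) =
    (\<Sum>y\<in>Q. prefix_boundary op (B y a) s) -
    frag_extend (block_sum Q j B) (rack_boundary op (Suc (j + length s)) (frag_of (p @ a # s)))"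
proof -
  let ?G = "block_sum Q j B"
  let ?sg = "\<lambda>k. frag_cmul ((- 1) ^ k)"
  let ?t = "\<lambda>y k. ?sg k (frag_of (B y a @ face0 k s) -
      frag_of (map (\<lambda>x. x \<star> (s ! (k - 1))) (B y a) @ face op k s))"
  have G: "?G (p' @ b # s') = (\<Sum>y\<in>Q. frag_of (B y b @ s'))" if "length p' = j" for p' b s'
    using that by (simp add: block_sum_def)
  have tr: "(\<Sum>y\<in>Q. frag_of (map (\<lambda>x. x \<star> c) (B y a) @ s')) =
      (\<Sum>y\<in>Q. frag_of (B y (a \<star> c) @ s'))" if "c \<in> Q" for c s'
    using sum_right_translate[OF that, of "\<lambda>y. frag_of (B y (a \<star> c) @ s')"] that Q
    by (simp add: equivariant)
  have "rack_boundary op (Suc (Suc (j + length s))) (?G (p @ a # s)) =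
      (\<Sum>y\<in>Q. rack_boundary op (length (B y a) + length s) (frag_of (B y a @ s)))"
    unfolding G[OF p] len using fin
    by (simp add: rack_boundary_def frag_extend_sum del: frag_extend_of)
  also have "\<dots> = (\<Sum>y\<in>Q. prefix_boundary op (B y a) s) +
      ?sg j (\<Sum>k = 1..length s. \<Sum>y\<in>Q. ?t y k)"
    unfolding rack_boundary_append sum.distrib unfolding len
    by (simp add: frag_cmul_sum sum.swap[of _ "{Suc 0..length s}" Q])
  also have "(\<Sum>k = 1..length s. \<Sum>y\<in>Q. ?t y k) = (\<Sum>k = 1..length s.
      ?sg k (?G ((p @ [a]) @ face0 k s) -
        ?G (map (\<lambda>x. x \<star> (s ! (k - 1))) (p @ [a]) @ face op k s)))"
  proof (rule sum.cong)
    fix k assume "k \<in> {1..length s}"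
    then have "s ! (k - 1) \<in> Q"
      using Q nth_mem[of "k - 1" s] by auto
    then show "(\<Sum>y\<in>Q. ?t y k) = ?sg k (?G ((p @ [a]) @ face0 k s) -
        ?G (map (\<lambda>x. x \<star> (s ! (k - 1))) (p @ [a]) @ face op k s))"
      using p by (simp add: G tr sum_subtractf flip: frag_cmul_sum)
  qed simp
  \<comment> \<open>The block has \<open>j + 2\<close> entries and \<open>p @ [a]\<close> only
    \<open>j + 1\<close>, whence the minus sign.\<close>
  also have "?sg j \<dots> = - frag_extend ?G (rack_boundary op (Suc (j + length s)) (frag_of (p @ a # s)))"
  proof -
    \<comment> \<open>\<open>?G\<close> ignores the first \<open>j\<close> entries, and the two faces differ only there.\<close>
    have "?G (face0 i (p @ [a]) @ s) = ?G (face op i (p @ [a]) @ s)" if "i \<in> {1..Suc j}" for i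
      using that p drop_face0[of i j "(p @ [a]) @ s"] drop_face[of i j "(p @ [a]) @ s" op]
        face0_append[of i "p @ [a]" s] face_append[of i "p @ [a]" op s]
      by (simp add: block_sum_def)
    then show ?thesis
      using frag_extend_rack_boundary_append[of ?G op "p @ [a]" s] p by simp
  qed
  finally show ?thesis by simp
qed

lemma prefix_boundary_append:
  "prefix_boundary f (u @ v) s = prefix_boundary f u (v @ s) +
    frag_cmul ((- 1) ^ length u) (\<Sum>k = 1..length v. frag_cmul ((- 1) ^ k)
      (frag_of (u @ face0 k v @ s) - frag_of (map (\<lambda>x. f x (v ! (k - 1))) u @ face f k v @ s)))"
  unfolding prefix_boundary_def length_append sum_atLeast1_add frag_cmul_sum
  by (intro arg_cong2[where f = plus] sum.cong refl)
    (simp_all add: face0_append face_append face0_append_right face_append_right power_add)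

text \<open>By idempotence, acting by \<open>y\<close> on copies of \<open>y\<close> changes
  nothing, so the two faces at each index coincide.\<close>

lemma prefix_boundary_replicate:
  assumes "y \<in> Q"
  shows "prefix_boundary op (replicate j y) s = 0"
  unfolding prefix_boundary_def
proof (rule sum.neutral, rule ballI)
  fix i assume "i \<in> {1..length (replicate j y)}"
  then have "1 \<le> i" "i \<le> j"
    by auto
  then have "face op i (replicate j y) = face0 i (replicate j y)"
    by (cases i) (simp_all add: face_def face0_def idem[OF assms])
  then show "frag_cmul ((- 1) ^ i)
      (frag_of (face0 i (replicate j y) @ s) - frag_of (face op i (replicate j y) @ s)) = 0"
    by simp
qed

end

section \<open>Division and the prefix homotopies in a finite quasigroup quandle\<close>

locale finite_quasigroup_quandle = quasigroup_quandle +
  assumes finite_carrier: "finite Q"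
begin

definition left_div :: "'a \<Rightarrow> 'a \<Rightarrow> 'a"
  where "left_div a b = (THE x. x \<in> Q \<and> a \<star> x = b)"

lemma
  assumes "a \<in> Q" "b \<in> Q"
  shows left_div_closed: "left_div a b \<in> Q"
    and mult_left_div: "a \<star> left_div a b = b"
  using theI'[OF left_unique_solution[OF assms]] by (simp_all add: left_div_def)

lemma left_div_eqI: "a \<in> Q \<Longrightarrow> x \<in> Q \<Longrightarrow> a \<star> x = b \<Longrightarrow> left_div a b = x"
  using left_unique_solution closed left_div_closed mult_left_div by metis

text \<open>Right translation by \<open>c\<close> is an endomorphism by self-distributivity, so it
  respects division. This makes \<open>div_block\<close> equivariant.\<close>

lemma left_div_mult_right:
  assumes "a \<in> Q" "b \<in> Q" "c \<in> Q"
  shows "left_div (a \<star> c) (b \<star> c) = left_div a b \<star> c"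
  using assms
  by (intro left_div_eqI) (simp_all add: closed left_div_closed mult_left_div flip: self_distrib)

lemma sum_left_translate:
  assumes "a \<in> Q"
  shows "(\<Sum>y\<in>Q. g (a \<star> y)) = (\<Sum>y\<in>Q. g y)"
proof -
  have "bij_betw (\<lambda>y. a \<star> y) Q Q"
    by (rule bij_betw_byWitness[where f' = "left_div a"])
      (use assms in \<open>auto simp: closed left_div_closed mult_left_div intro: left_div_eqI\<close>)
  then show ?thesis
    by (rule sum.reindex_bij_betw)
qed

text \<open>Deleting \<open>left_div y a\<close> with its action turns the copies of
  \<open>y\<close> into copies of \<open>a\<close>.\<close>

definition div_block :: "nat \<Rightarrow> 'a \<Rightarrow> 'a \<Rightarrow> 'a list"
  where "div_block j y a = replicate j y @ [left_div y a, a]"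

text \<open>Deleting the final \<open>y\<close> with its action turns the copies of \<open>a\<close>
  into copies of \<open>a \<star> y\<close>, which runs through \<open>Q\<close> with
  \<open>y\<close>.\<close>

definition repeat_block :: "nat \<Rightarrow> 'a \<Rightarrow> 'a \<Rightarrow> 'a list"
  where "repeat_block j y a = replicate (Suc j) a @ [y]"

definition prefix_homotopy :: "nat \<Rightarrow> 'a list \<Rightarrow> ('a list \<Rightarrow>\<^sub>0 int)"
  where "prefix_homotopy j xs = block_sum Q j (div_block j) xs - block_sum Q j (repeat_block j) xs"

text \<open>The faces at \<open>left_div y a\<close> give the right-hand side. Those at the last
  entry \<open>a\<close> cancel in the sum: \<open>left_div y a \<star> a\<close> equals
  \<open>left_div (y \<star> a) a\<close> by idempotence, and \<open>y \<star> a\<close> runs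
  through \<open>Q\<close> with \<open>y\<close>.\<close>

lemma sum_prefix_boundary_div_block:
  assumes "a \<in> Q"
  shows "(\<Sum>y\<in>Q. prefix_boundary op (div_block j y a) s) = frag_cmul ((- 1) ^ Suc j)
    ((\<Sum>y\<in>Q. frag_of (replicate j y @ a # s)) - (\<Sum>y\<in>Q. frag_of (replicate j a @ a # s)))"
proof -
  let ?g = "\<lambda>y. frag_of (replicate j y @ left_div y a # s)"
  have "prefix_boundary op (div_block j y a) s = frag_cmul ((- 1) ^ Suc j)
      (frag_of (replicate j y @ a # s) - frag_of (replicate j a @ a # s)) +
      frag_cmul ((- 1) ^ j) (?g y - ?g (y \<star> a))" if "y \<in> Q" for y
    using that assms left_div_mult_right[of y a a]
    by (simp add: div_block_def prefix_boundary_append prefix_boundary_replicate face0_def face_def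
        mult_left_div idem frag_cmul_distrib2 frag_cmul_diff_distrib2 numeral_2_eq_2 flip: minus_frag_cmul)
  then have "(\<Sum>y\<in>Q. prefix_boundary op (div_block j y a) s) = frag_cmul ((- 1) ^ Suc j)
      ((\<Sum>y\<in>Q. frag_of (replicate j y @ a # s)) - (\<Sum>y\<in>Q. frag_of (replicate j a @ a # s))) +
      frag_cmul ((- 1) ^ j) ((\<Sum>y\<in>Q. ?g y) - (\<Sum>y\<in>Q. ?g (y \<star> a)))"
    by (simp only: sum.distrib sum_subtractf cong: sum.cong flip: frag_cmul_sum)
  then show ?thesis
    using sum_right_translate[OF assms, of ?g] by simp
qed

text \<open>The constant part contributes nothing, so only the two faces at the final
  \<open>y\<close> count; left translation by \<open>a\<close> then reindexes the sum.\<close>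

lemma sum_prefix_boundary_repeat_block:
  assumes "a \<in> Q"
  shows "(\<Sum>y\<in>Q. prefix_boundary op (repeat_block j y a) s) = frag_cmul ((- 1) ^ Suc j)
    ((\<Sum>y\<in>Q. frag_of (replicate (Suc j) y @ s)) - (\<Sum>y\<in>Q. frag_of (replicate j a @ a # s)))"
proof -
  let ?g = "\<lambda>y. frag_of (replicate (Suc j) y @ s)"
  have "prefix_boundary op (repeat_block j y a) s = frag_cmul ((- 1) ^ Suc j)
      (?g (a \<star> y) - frag_of (replicate j a @ a # s))" for y
    using assms prefix_boundary_replicate[OF assms, of "Suc j" "[y] @ s"]
    unfolding repeat_block_def prefix_boundary_append
    by (simp add: face0_def face_def frag_cmul_diff_distrib2
        flip: minus_frag_cmul replicate_append_same)
  then show ?thesis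
    using sum_left_translate[OF assms, of ?g]
    by (simp only: sum_subtractf flip: frag_cmul_sum)
qed

text \<open>Both block sums produce the same term with prefix \<open>a, ..., a\<close>, which
  cancels in their difference.\<close>

lemma rack_boundary_prefix_homotopy:
  assumes "xs \<in> tuples Q n" "j < n"
  shows "rack_boundary op (Suc n) (prefix_homotopy j xs) =
    frag_cmul ((- 1) ^ Suc j) (constant_prefix_sum Q j xs - constant_prefix_sum Q (Suc j) xs) -
    frag_extend (prefix_homotopy j) (rack_boundary op n (frag_of xs))"
proof -
  define p a s where "p = take j xs" and "a = xs ! j" and "s = drop (Suc j) xs"
  have xs: "xs = p @ a # s" and p: "length p = j" and n: "n = Suc (j + length s)"
    using assms by (auto simp: tuples_def p_def a_def s_def id_take_nth_drop[symmetric])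
  have Q: "a \<in> Q" "set s \<subseteq> Q"
    using assms(1) xs by (auto simp: tuples_def)
  have div: "rack_boundary op (Suc n) (block_sum Q j (div_block j) xs) =
      (\<Sum>y\<in>Q. prefix_boundary op (div_block j y a) s) -
      frag_extend (block_sum Q j (div_block j)) (rack_boundary op n (frag_of xs))"
    unfolding xs n using Q p
    by (intro rack_boundary_block_sum finite_carrier)
      (simp_all add: div_block_def left_div_mult_right)
  have rep: "rack_boundary op (Suc n) (block_sum Q j (repeat_block j) xs) =
      (\<Sum>y\<in>Q. prefix_boundary op (repeat_block j y a) s) -
      frag_extend (block_sum Q j (repeat_block j)) (rack_boundary op n (frag_of xs))"
    unfolding xs n using Q p
    by (intro rack_boundary_block_sum finite_carrier) (simp_all add: repeat_block_def)
  have "constant_prefix_sum Q j xs = (\<Sum>y\<in>Q. frag_of (replicate j y @ a # s))"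
    "constant_prefix_sum Q (Suc j) xs = (\<Sum>y\<in>Q. frag_of (replicate (Suc j) y @ s))"
    unfolding constant_prefix_sum_def using xs p by simp_all
  then show ?thesis
    unfolding prefix_homotopy_def frag_extend_diff_fun
    using div rep sum_prefix_boundary_div_block[OF Q(1), of j s]
      sum_prefix_boundary_repeat_block[OF Q(1), of j s]
    by (simp add: rack_boundary_def frag_extend_diff frag_cmul_diff_distrib2)
qed

lemma keys_prefix_homotopy:
  assumes "xs \<in> tuples Q n" "j < n"
  shows "Poly_Mapping.keys (prefix_homotopy j xs) \<subseteq> tuples Q (Suc n)"
proof -
  define p a s where "p = take j xs" and "a = xs ! j" and "s = drop (Suc j) xs"
  have xs: "xs = p @ a # s" and p: "length p = j" and n: "n = Suc (j + length s)"
    using assms by (auto simp: tuples_def p_def a_def s_def id_take_nth_drop[symmetric])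
  have Q: "a \<in> Q" "set s \<subseteq> Q"
    using assms(1) xs by (auto simp: tuples_def)
  have "div_block j y a @ s \<in> tuples Q (Suc n)" "repeat_block j y a @ s \<in> tuples Q (Suc n)"
    if "y \<in> Q" for y
    using that Q n left_div_closed[of y a]
    by (auto simp: tuples_def div_block_def repeat_block_def)
  then show ?thesis
    unfolding prefix_homotopy_def block_sum_def xs using p
    by (auto dest!: subsetD[OF keys_diff] subsetD[OF keys_sum])
qed

lemma rack_boundary_frag_extend_prefix_homotopy:
  assumes "Poly_Mapping.keys c \<subseteq> tuples Q n" "j < n"
  shows "rack_boundary op (Suc n) (frag_extend (prefix_homotopy j) c) =
    frag_cmul ((- 1) ^ Suc j)
      (frag_extend (constant_prefix_sum Q j) c - frag_extend (constant_prefix_sum Q (Suc j)) c) -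
    frag_extend (prefix_homotopy j) (rack_boundary op n c)"
  using assms(1)
proof (induction c rule: free_Abelian_group_induct[consumes 1, case_names zero diff basis])
  case zero
  then show ?case
    by (simp add: rack_boundary_def)
next
  case (diff c d)
  then show ?case
    by (simp add: rack_boundary_def frag_extend_diff frag_cmul_diff_distrib2)
next
  case (basis xs)
  then show ?case
    using rack_boundary_prefix_homotopy[OF _ assms(2)] by simp
qed

lemma constant_prefix_sum_diff_boundary:
  assumes "c \<in> rack_cycles Q op n" "j < n"
  shows "frag_extend (constant_prefix_sum Q j) c - frag_extend (constant_prefix_sum Q (Suc j)) c
    \<in> rack_boundaries Q op n"
proof -
  have c: "Poly_Mapping.keys c \<subseteq> tuples Q n" "rack_boundary op n c = 0"
    using assms(1) by (simp_all add: rack_cycles_def rack_chain_group_def)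
  \<comment> \<open>The sign is chosen to cancel the one in the homotopy identity; the remaining
    term vanishes because \<open>c\<close> is a cycle.\<close>
  let ?e = "frag_cmul ((- 1) ^ Suc j) (frag_extend (prefix_homotopy j) c)"
  have "rack_boundary op (Suc n) ?e =
      frag_cmul ((- 1) ^ Suc j) (rack_boundary op (Suc n) (frag_extend (prefix_homotopy j) c))"
    unfolding rack_boundary_def frag_extend_cmul ..
  then have "rack_boundary op (Suc n) ?e =
      frag_extend (constant_prefix_sum Q j) c - frag_extend (constant_prefix_sum Q (Suc j)) c"
    unfolding rack_boundary_frag_extend_prefix_homotopy[OF c(1) assms(2)] c(2)
    by (simp flip: power_add mult_2)
  moreover have "?e \<in> carrier (rack_chain_group Q (Suc n))"
    using c(1) keys_prefix_homotopy[OF _ assms(2)]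
    by (auto simp: rack_chain_group_def dest!: subsetD[OF keys_cmul] subsetD[OF keys_frag_extend])
  ultimately show ?thesis
    unfolding rack_boundaries_def by (metis imageI)
qed

end

section \<open>Cycles and boundaries as subgroups of the chain group\<close>

lemma face0_in_tuples:
  "xs \<in> tuples X (Suc n) \<Longrightarrow> i \<in> {1..Suc n} \<Longrightarrow> face0 i xs \<in> tuples X n"
  by (auto simp: tuples_def face0_def dest: in_set_takeD in_set_dropD)

lemma (in quandle) face_in_tuples:
  assumes "xs \<in> tuples Q (Suc n)" "i \<in> {1..Suc n}"
  shows "face op i xs \<in> tuples Q n"
proof -
  have "xs ! (i - 1) \<in> Q"
    using assms nth_mem[of "i - 1" xs] by (auto simp: tuples_def)
  then show ?thesis
    using assms by (auto simp: tuples_def face_def dest: in_set_dropD intro!: closed dest!: in_set_takeD)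
qed

lemma (in quandle) keys_rack_boundary:
  assumes "Poly_Mapping.keys c \<subseteq> tuples Q (Suc n)"
  shows "Poly_Mapping.keys (rack_boundary op (Suc n) c) \<subseteq> tuples Q n"
  unfolding rack_boundary_def
proof (rule order_trans[OF keys_frag_extend], rule UN_least)
  fix xs assume "xs \<in> Poly_Mapping.keys c"
  then have xs: "xs \<in> tuples Q (Suc n)"
    using assms by blast
  show "Poly_Mapping.keys (\<Sum>i = 1..Suc n. frag_cmul ((- 1) ^ i)
      (frag_of (face0 i xs) - frag_of (face op i xs))) \<subseteq> tuples Q n"
  proof (rule order_trans[OF keys_sum], rule UN_least)
    fix i assume "i \<in> {1..Suc n}"
    then show "Poly_Mapping.keys (frag_cmul ((- 1) ^ i)
        (frag_of (face0 i xs) - frag_of (face op i xs))) \<subseteq> tuples Q n"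
      using face0_in_tuples[OF xs] face_in_tuples[OF xs]
      by (intro order_trans[OF keys_cmul] order_trans[OF keys_diff]) simp
  qed
qed

lemma (in quandle) subgroup_rack_boundaries:
  "subgroup (rack_boundaries Q op n) (rack_chain_group Q n)"
proof -
  have "rack_boundary op (Suc n) \<in> hom (rack_chain_group Q (Suc n)) (rack_chain_group Q n)"
    using keys_rack_boundary
    by (intro homI) (simp_all add: rack_chain_group_def, simp add: rack_boundary_def frag_extend_add)
  then show ?thesis
    unfolding rack_boundaries_def
    by (intro group_hom.img_is_subgroup)
      (simp add: group_hom_def group_hom_axioms_def rack_chain_group_def)
qed

lemma subgroup_rack_cycles: "subgroup (rack_cycles X f n) (rack_chain_group X n)"
proof (rule group.subgroupI)
  have "0 \<in> rack_cycles X f n"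
    by (simp add: rack_cycles_def rack_chain_group_def rack_boundary_def)
  then show "rack_cycles X f n \<noteq> {}"
    by blast
qed (auto simp: rack_cycles_def rack_chain_group_def rack_boundary_def frag_extend_add
    frag_extend_minus dest!: subsetD[OF keys_add])

text \<open>Both faces of an \<open>(n + 1)\<close>-tuple have length \<open>n\<close>, so
  \<open>drop n\<close> empties them and \<open>constant_prefix_sum X n\<close> takes the same value
  on both.\<close>

lemma frag_extend_constant_prefix_sum_boundary:
  assumes "c \<in> rack_boundaries X f n"
  shows "frag_extend (constant_prefix_sum X n) c = 0"
proof -
  obtain b where b: "Poly_Mapping.keys b \<subseteq> tuples X (Suc n)" "c = rack_boundary f (Suc n) b"
    using assms by (auto simp: rack_boundaries_def rack_chain_group_def)
  have "frag_extend (constant_prefix_sum X n) (rack_boundary f (Suc n) b) = 0"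
    using b(1)
  proof (induction b rule: free_Abelian_group_induct[consumes 1, case_names zero diff basis])
    case (basis xs)
    then show ?case
      unfolding frag_extend_rack_boundary
      by (intro sum.neutral) (auto simp: constant_prefix_sum_def tuples_def face0_def face_def)
  qed (simp_all add: rack_boundary_def frag_extend_diff)
  then show ?thesis
    using b by simp
qed

section \<open>Multiplication by the order of \<open>Q\<close> on torsion cycles\<close>

context finite_quasigroup_quandle
begin

lemma constant_prefix_sum_0: "frag_extend (constant_prefix_sum Q 0) c = frag_cmul (int (card Q)) c"
proof -
  have "constant_prefix_sum Q 0 = (\<lambda>xs. frag_cmul (int (card Q)) (frag_of xs))"
    by (rule ext, rule poly_mapping_eqI) (simp add: constant_prefix_sum_def lookup_sum)
  then show ?thesis
    by (subst (2) frag_expansion) (simp add: frag_extend_def frag_cmul_sum mult.commute)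
qed

text \<open>The differences of consecutive maps \<open>constant_prefix_sum Q m\<close> telescope,
  starting from multiplication by \<open>card Q\<close> at \<open>m = 0\<close>.\<close>

lemma card_cmul_diff_boundary:
  assumes "c \<in> rack_cycles Q op n" "m \<le> n"
  shows "frag_cmul (int (card Q)) c - frag_extend (constant_prefix_sum Q m) c
    \<in> rack_boundaries Q op n"
  using assms(2)
proof (induction m)
  case 0
  then show ?case
    using subgroup.one_closed[OF subgroup_rack_boundaries, of n]
    by (simp add: constant_prefix_sum_0 rack_chain_group_def)
next
  case (Suc m)
  then show ?case
    using subgroup.m_closed[OF subgroup_rack_boundaries, OF Suc.IH
        constant_prefix_sum_diff_boundary[OF assms(1), of m]]
    by (simp add: rack_chain_group_def)
qed

lemma card_cmul_torsion_cycle: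
  assumes "c \<in> rack_cycles Q op n" "k > 0" "frag_cmul (int k) c \<in> rack_boundaries Q op n"
  shows "frag_cmul (int (card Q)) c \<in> rack_boundaries Q op n"
proof -
  \<comment> \<open>The map kills \<open>k\<close> times \<open>c\<close>, and the free abelian
    group has no torsion, so the positive factor \<open>k\<close> cancels.\<close>
  have "frag_extend (constant_prefix_sum Q n) c = 0"
    using frag_extend_constant_prefix_sum_boundary[OF assms(3)] assms(2)
    by (simp add: frag_extend_cmul)
  then show ?thesis
    using card_cmul_diff_boundary[OF assms(1), of n] by simp
qed

end

section \<open>Passage from chains to homology classes\<close>

text \<open>Moves powers in the homology group to the quotient of the whole chain group, so that it is
  not needed that boundaries are cycles.\<close>

lemma pow_FactGroup_subgroup_generated:
  "pow (subgroup_generated G S Mod N) = (pow (G Mod N) :: 'a set \<Rightarrow> nat \<Rightarrow> 'a set)"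
  by (intro ext) (simp add: nat_pow_def set_mult_def[abs_def])

text \<open>Brings the statement down to chains. It serves twice: with the exponent that witnesses
  torsion, and with \<open>card Q\<close>.\<close>

lemma (in quandle) rack_homology_pow_eq_one_iff:
  assumes "c \<in> rack_cycles Q op n"
  shows "(rack_boundaries Q op n #>\<^bsub>rack_chain_group Q n\<^esub> c) [^]\<^bsub>rack_homology_group Q op n\<^esub> (k :: nat)
      = \<one>\<^bsub>rack_homology_group Q op n\<^esub> \<longleftrightarrow>
    frag_cmul (int k) c \<in> rack_boundaries Q op n"
proof -
  let ?C = "rack_chain_group Q n" and ?B = "rack_boundaries Q op n"
  interpret C: comm_group ?C
    by (simp add: rack_chain_group_def abelian_free_Abelian_group)
  have "?B \<lhd> ?C"
    by (rule C.normal_iff_subgroup[THEN iffD2, OF subgroup_rack_boundaries])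
  moreover have c: "c \<in> carrier ?C"
    using assms by (simp add: rack_cycles_def)
  moreover have "c [^]\<^bsub>?C\<^esub> k = frag_cmul (int k) c"
    by (simp add: rack_chain_group_def)
  ultimately have "(?B #>\<^bsub>?C\<^esub> c) [^]\<^bsub>rack_homology_group Q op n\<^esub> k = ?B #>\<^bsub>?C\<^esub> frag_cmul (int k) c"
    "frag_cmul (int k) c \<in> carrier ?C"
    using normal.FactGroup_pow[of ?B ?C c k] C.nat_pow_closed[OF c, of k]
    by (simp_all add: rack_homology_group_def pow_FactGroup_subgroup_generated)
  then show ?thesis
    using C.coset_join1[OF _ _ subgroup_rack_boundaries] C.coset_join2[OF _ subgroup_rack_boundaries]
    by (auto simp: rack_homology_group_def subgroup.subset[OF subgroup_rack_boundaries])
qed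

text \<open>The cycles form a subgroup, hence generate only themselves, and
  \<open>subgroup_generated\<close> keeps the multiplication, so cosets may be taken in the whole
  chain group.\<close>

lemma carrier_rack_homology_group:
  "carrier (rack_homology_group X f n) =
    (\<lambda>c. rack_boundaries X f n #>\<^bsub>rack_chain_group X n\<^esub> c) ` rack_cycles X f n"
  by (simp add: rack_homology_group_def carrier_FactGroup r_coset_def
      subgroup.carrier_subgroup_generated_subgroup[OF subgroup_rack_cycles])

theorem theorem2p1:
  fixes Q :: "'a set" and f :: "'a \<Rightarrow> 'a \<Rightarrow> 'a" and n :: nat
  assumes "quasigroup_quandle Q f"
    and "finite Q"
  shows "\<forall>z \<in> torsion_subgroup (rack_homology_group Q f n).
    z [^]\<^bsub>rack_homology_group Q f n\<^esub> card Q = \<one>\<^bsub>rack_homology_group Q f n\<^esub>"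
proof -
  interpret finite_quasigroup_quandle Q f
    using assms by (simp add: finite_quasigroup_quandle_def finite_quasigroup_quandle_axioms_def)
  show ?thesis
  proof
    fix z assume "z \<in> torsion_subgroup (rack_homology_group Q f n)"
    \<comment> \<open>A torsion class is represented by a cycle \<open>c\<close> with a positive
      multiple that is a boundary.\<close>
    then obtain c k where c: "c \<in> rack_cycles Q f n" "k > 0"
        "frag_cmul (int k) c \<in> rack_boundaries Q f n"
      and z: "z = rack_boundaries Q f n #>\<^bsub>rack_chain_group Q n\<^esub> c"
      by (auto simp: torsion_subgroup_def carrier_rack_homology_group rack_homology_pow_eq_one_iff)
    show "z [^]\<^bsub>rack_homology_group Q f n\<^esub> card Q = \<one>\<^bsub>rack_homology_group Q f n\<^esub>"
      unfolding z rack_homology_pow_eq_one_iff[OF c(1)] using card_cmul_torsion_cycle[OF c] .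
  qed
qed

end
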